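(* For any $p\in\mathbb{Z}^+$ let $L(p)=\{a^{kp}\mid k\in\mathbb{Z}^+\}$, a language over the alphabet $\{a\}$. For any $p\in\mathbb{Z}^+$ and any $0<\varepsilon\le\frac12$, the language $L(p)$ can be recognized with one-sided error $\varepsilon$ by a 2QCFA $\mathcal{A}(p,\varepsilon)$ with 2 quantum basis states and a constant number of classical states (depending neither on $p$ nor on $\varepsilon$), in expected running time $O\!\left(\frac{1}{\varepsilon}p^2 n\right)$, where $n$ is the length of the input.
   Context: A 2QCFA (two-way finite automaton with quantum and classical states) is a 9-tuple $(Q,S,\Sigma,\Theta,\delta,|q_0\rangle,s_0,S_{acc},S_{rej})$, where $Q$ is a finite set of orthonormal quantum basis states spanning a Hilbert space $H(Q)$; $S$ is a finite set of classical states; $\Sigma$ is a finite input alphabet, and $\Sigma'$ is $\Sigma$ together with a left end-marker and a right end-marker; $|q_0\rangle\in Q$ is the initial quantum state; $s_0\in S$ is the initial classical state; $S_{acc},S_{rej}\subset S$ are disjoint sets of accepting and rejecting states. The quantum transition function $\Theta$ assigns to every pair $(s,\sigma)\in (S\setminus(S_{acc}\cup S_{rej}))\times\Sigma'$ either a unitary operation on $H(Q)$ or a projective measurement on $H(Q)$. The computation on $w\in\Sigma^*$ starts with $w$ between the end-markers on the tape, the head on the left end-marker, classical state $s_0$ and quantum state $|q_0\rangle$. In each step, with classical state $s$ and scanned symbol $\sigma$: if $\Theta(s,\sigma)$ is unitary, it is applied to the quantum state, and $\delta(s,\sigma)=(s',d)\in S\times\{-1,0,1\}$ gives the new classical state $s'$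 and head movement $d$; if $\Theta(s,\sigma)$ is a projective measurement $\{P_1,\dots,P_k\}$, then outcome $i$ occurs with probability $\|P_i|\psi\rangle\|^2$ (where $|\psi\rangle$ is the current quantum state), the quantum state becomes $P_i|\psi\rangle/\|P_i|\psi\rangle\|$, and $\delta(s,\sigma)(i)=(s',d)\in S\times\{-1,0,1\}$ gives the new classical state and head movement. The automaton halts and accepts (rejects) when it enters a state of $S_{acc}$ ($S_{rej}$). $\Pr[\mathcal{A}\text{ accepts }w]$ and $\Pr[\mathcal{A}\text{ rejects }w]$ are the total probabilities of ever halting in acceptance, respectively rejection. The running time is the number of steps until halting. The number of quantum basis states is $|Q|$, the number of classical states is $|S|$. $\mathcal{A}$ recognizes $L\subset\Sigma^*$ with one-sided error $\varepsilon$ if $\Pr[\mathcal{A}\text{ accepts }w]=1$ for all $w\in L$, and $\Pr[\mathcal{A}\text{ rejects }w]\ge 1-\varepsilon$ for all $w\in\Sigma^*\setminus L$. The constant in $O(\cdot)$ is absolute (independent of $p$, $\varepsilon$ and the input), and the bound is understood for inputs of length $n\ge 1$. *)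

theory Defs
  imports "HOL-Analysis.Analysis"
begin

section \<open>Unitaries and projective measurements on a finite-dimensional Hilbert space\<close>

text \<open>
  The Hilbert space spanned by the orthonormal basis states \<open>'q\<close> is \<open>complex ^ 'q\<close>, the basis
  state \<open>q\<close> being \<open>axis q 1\<close>.  Its norm is the Euclidean (hence the Hilbert space) norm.
\<close>

definition conj_transpose :: "complex ^ 'n ^ 'm \<Rightarrow> complex ^ 'm ^ 'n" where
  "conj_transpose M = map_matrix cnj (transpose M)"

definition is_unitary :: "complex ^ 'q ^ 'q \<Rightarrow> bool" where
  "is_unitary U \<longleftrightarrow> U ** conj_transpose U = mat 1 \<and> conj_transpose U ** U = mat 1"

definition is_projective_measurement :: "(complex ^ 'q ^ 'q) list \<Rightarrow> bool" where
  "is_projective_measurement Ps \<longleftrightarrow>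
     (\<forall>P\<in>set Ps. conj_transpose P = P \<and> P ** P = P) \<and>
     (\<forall>i<length Ps. \<forall>j<length Ps. i \<noteq> j \<longrightarrow> Ps ! i ** Ps ! j = 0) \<and>
     (\<Sum>i<length Ps. Ps ! i) = mat 1"

datatype 'q operation =
    Unitary "complex ^ 'q ^ 'q"
  | Measurement "(complex ^ 'q ^ 'q) list"

section \<open>Two-way finite automata with quantum and classical states\<close>

datatype 'a tape_symbol = Left_End | Right_End | Letter 'a

text \<open>
  The set of quantum basis states is the finite type \<open>'q\<close>; the other eight components are the
  fields of the record.  The third argument of \<open>delta\<close> is the measurement outcome, numbered
  from 0; when a unitary is applied, only the argument 0 is used.
\<close>

record ('q, 's, 'a) qcfa =
  states :: "'s set"
  alphabet :: "'a set"
  Theta :: "'s \<Rightarrow> 'a tape_symbol \<Rightarrow> 'q operation"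
  delta :: "'s \<Rightarrow> 'a tape_symbol \<Rightarrow> nat \<Rightarrow> 's \<times> int"
  init_quantum :: 'q
  init_state :: 's
  acc_states :: "'s set"
  rej_states :: "'s set"

definition num_quantum_states :: "('q::finite, 's, 'a) qcfa \<Rightarrow> nat" where
  "num_quantum_states A = CARD('q)"

definition num_classical_states :: "('q, 's, 'a) qcfa \<Rightarrow> nat" where
  "num_classical_states A = card (states A)"

definition halting_states :: "('q, 's, 'a) qcfa \<Rightarrow> 's set" where
  "halting_states A = acc_states A \<union> rej_states A"

definition tape_alphabet :: "('q, 's, 'a) qcfa \<Rightarrow> 'a tape_symbol set" where
  "tape_alphabet A = {Left_End, Right_End} \<union> Letter ` alphabet A"

text \<open>The head never moves off the tape, i.e. past an end-marker.\<close>

definition valid_move :: "('q, 's, 'a) qcfa \<Rightarrow> 'a tape_symbol \<Rightarrow> 's \<times> int \<Rightarrow> bool" where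
  "valid_move A \<sigma> m \<longleftrightarrow>
     fst m \<in> states A \<and> snd m \<in> {-1, 0, 1} \<and>
     (\<sigma> = Left_End \<longrightarrow> snd m \<noteq> -1) \<and> (\<sigma> = Right_End \<longrightarrow> snd m \<noteq> 1)"

definition is_qcfa :: "('q::finite, 's, 'a) qcfa \<Rightarrow> bool" where
  "is_qcfa A \<longleftrightarrow>
     finite (states A) \<and> finite (alphabet A) \<and>
     init_state A \<in> states A \<and>
     acc_states A \<subseteq> states A \<and> rej_states A \<subseteq> states A \<and>
     acc_states A \<inter> rej_states A = {} \<and>
     (\<forall>s \<in> states A - halting_states A. \<forall>\<sigma> \<in> tape_alphabet A.
        case Theta A s \<sigma> of
          Unitary U \<Rightarrow> is_unitary U \<and> valid_move A \<sigma> (delta A s \<sigma> 0)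
        | Measurement Ps \<Rightarrow> is_projective_measurement Ps \<and>
            (\<forall>i<length Ps. valid_move A \<sigma> (delta A s \<sigma> i)))"

section \<open>Computations\<close>

text \<open>
  On input \<open>w\<close>, cell 0 holds the left end-marker, cells \<open>1, \<dots>, length w\<close> hold \<open>w\<close>, and cell
  \<open>length w + 1\<close> holds the right end-marker; the head of a \<open>qcfa\<close> stays in these cells.
\<close>

definition scanned :: "'a list \<Rightarrow> int \<Rightarrow> 'a tape_symbol" where
  "scanned w h =
     (if h \<le> 0 then Left_End
      else if h \<le> int (length w) then Letter (w ! nat (h - 1))
      else Right_End)"

type_synonym ('q, 's) config = "'s \<times> int \<times> (complex ^ 'q)"

definition initial_config :: "('q::finite, 's, 'a) qcfa \<Rightarrow> ('q, 's) config" where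
  "initial_config A = (init_state A, 0, axis (init_quantum A) 1)"

text \<open>
  The possible successors of a non-halting configuration, with their probabilities.  (A
  measurement outcome of probability 0 contributes a successor of weight 0.)
\<close>

fun successors ::
  "('q::finite, 's, 'a) qcfa \<Rightarrow> 'a list \<Rightarrow> ('q, 's) config \<Rightarrow> (real \<times> ('q, 's) config) list"
where
  "successors A w (s, h, \<psi>) =
     (let \<sigma> = scanned w h in
      case Theta A s \<sigma> of
        Unitary U \<Rightarrow>
          (case delta A s \<sigma> 0 of (s', d) \<Rightarrow> [(1, (s', h + d, U *v \<psi>))])
      | Measurement Ps \<Rightarrow>
          map (\<lambda>i. case delta A s \<sigma> i of (s', d) \<Rightarrow>
                 let \<phi> = Ps ! i *v \<psi>
                 in ((norm \<phi>)\<^sup>2, (s', h + d, \<phi> /\<^sub>R norm \<phi>)))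
              [0..<length Ps])"

text \<open>
  \<open>halt_prob A w X t c\<close> is the probability that the computation on \<open>w\<close> starting in
  configuration \<open>c\<close> makes exactly \<open>t\<close> steps and then halts in a state of \<open>X\<close>; that is, the
  sum over all branches of this kind of the product of their step probabilities.
\<close>

primrec halt_prob ::
  "('q::finite, 's, 'a) qcfa \<Rightarrow> 'a list \<Rightarrow> 's set \<Rightarrow> nat \<Rightarrow> ('q, 's) config \<Rightarrow> real"
where
  "halt_prob A w X 0 c = (if fst c \<in> halting_states A \<inter> X then 1 else 0)"
| "halt_prob A w X (Suc t) c =
     (if fst c \<in> halting_states A then 0
      else \<Sum>(p, c') \<leftarrow> successors A w c. p * halt_prob A w X t c')"

definition accept_prob :: "('q::finite, 's, 'a) qcfa \<Rightarrow> 'a list \<Rightarrow> ennreal" where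
  "accept_prob A w = (\<Sum>t. ennreal (halt_prob A w (acc_states A) t (initial_config A)))"

definition reject_prob :: "('q::finite, 's, 'a) qcfa \<Rightarrow> 'a list \<Rightarrow> ennreal" where
  "reject_prob A w = (\<Sum>t. ennreal (halt_prob A w (rej_states A) t (initial_config A)))"

definition running_time_prob :: "('q::finite, 's, 'a) qcfa \<Rightarrow> 'a list \<Rightarrow> nat \<Rightarrow> ennreal" where
  "running_time_prob A w t = ennreal (halt_prob A w (halting_states A) t (initial_config A))"

text \<open>The running time of a computation that never halts is \<open>\<infinity>\<close>.\<close>

definition expected_running_time :: "('q::finite, 's, 'a) qcfa \<Rightarrow> 'a list \<Rightarrow> ennreal" where
  "expected_running_time A w =
     (\<Sum>t. of_nat t * running_time_prob A w t) + \<infinity> * (1 - (\<Sum>t. running_time_prob A w t))"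

definition recognizes_one_sided ::
  "('q::finite, 's, 'a) qcfa \<Rightarrow> 'a list set \<Rightarrow> real \<Rightarrow> bool"
where
  "recognizes_one_sided A L \<epsilon> \<longleftrightarrow>
     L \<subseteq> lists (alphabet A) \<and>
     (\<forall>w \<in> L. accept_prob A w = 1) \<and>
     (\<forall>w \<in> lists (alphabet A) - L. reject_prob A w \<ge> ennreal (1 - \<epsilon>))"

definition multiples_language :: "'a \<Rightarrow> nat \<Rightarrow> 'a list set" where
  "multiples_language a p = {replicate (k * p) a | k. k > 0}"

end

theory Submission
  imports Defs
begin

text \<open>
  Rotating the qubit by \<open>\<pi> / p\<close> on each letter and measuring at the right end rejects \<open>a\<^sup>n\<close> with
  probability \<open>r = sin\<^sup>2 (\<pi> n / p)\<close>, which is 0 if \<open>p\<close> divides \<open>n\<close> and at least \<open>1 / p\<^sup>2\<close> otherwise.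
  If this does not happen, a quantum coin of bias \<open>d = \<epsilon> / p\<^sup>2\<close> decides whether to accept or to
  return to the left end and repeat.  The qubit is back in its initial state up to sign, so the rounds
  are independent: nonmembers are rejected with probability \<open>r / (r + (1 - r) d) \<ge> 1 - \<epsilon>\<close>, and since
  a round takes at most \<open>2 n + 4\<close> steps and halts with probability at least \<open>d\<close>, the expected running
  time is at most \<open>(2 n + 4) / d\<close>.
\<close>

section \<open>Rotations and measurements of a real qubit\<close>

definition rot :: "real \<Rightarrow> complex ^ 2 ^ 2" where
  "rot \<alpha> = vector [vector [of_real (cos \<alpha>), - of_real (sin \<alpha>)],
                   vector [of_real (sin \<alpha>), of_real (cos \<alpha>)]]"

text \<open>Every operation used is real, so one angle describes the qubit and a rotation adds to
  it.\<close>

definition ket :: "real \<Rightarrow> complex ^ 2" where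
  "ket \<beta> = vector [of_real (cos \<beta>), of_real (sin \<beta>)]"

definition proj :: "2 \<Rightarrow> complex ^ 2 ^ 2" where
  "proj k = (\<chi> i j. if i = k \<and> j = k then 1 else 0)"

lemma is_unitary_rot: "is_unitary (rot \<alpha>)"
proof -
  have "complex_of_real (cos \<alpha>) * of_real (cos \<alpha>) + of_real (sin \<alpha>) * of_real (sin \<alpha>) = 1"
    by (metis of_real_1 of_real_add of_real_mult power2_eq_square sin_cos_squared_add2)
  then show ?thesis
    by (simp add: is_unitary_def conj_transpose_def map_matrix_def transpose_def rot_def
        vec_eq_iff forall_2 matrix_matrix_mult_def sum_2 mat_def algebra_simps)
qed

lemma rot_mult_ket: "rot \<alpha> *v ket \<beta> = ket (\<beta> + \<alpha>)"
  by (simp add: vec_eq_iff forall_2 rot_def ket_def matrix_vector_mult_def sum_2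
      cos_add sin_add algebra_simps)

lemma axis_1_eq_ket: "axis 1 1 = ket 0"
  by (simp add: vec_eq_iff forall_2 ket_def axis_def)

lemma is_projective_measurement_proj: "is_projective_measurement [proj 1, proj 2]"
  by (auto simp: is_projective_measurement_def conj_transpose_def map_matrix_def transpose_def
      proj_def vec_eq_iff forall_2 matrix_matrix_mult_def sum_2 mat_def less_Suc_eq numeral_2_eq_2)

lemma norm_proj_ket:
  "norm (proj 1 *v ket \<beta>) = \<bar>cos \<beta>\<bar>" "norm (proj 2 *v ket \<beta>) = \<bar>sin \<beta>\<bar>"
  by (simp_all add: proj_def ket_def norm_vec_def L2_set_def matrix_vector_mult_def sum_2)

text \<open>The projection leaves \<open>cos \<beta>\<close> times the first basis vector;
  normalising keeps only the sign, that is, angle 0 or \<open>pi\<close>. The condition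
  \<open>sin \<gamma> = 0\<close> covers both.\<close>

lemma normalized_proj_1_ket:
  assumes "cos \<beta> \<noteq> 0"
  obtains \<gamma> where "sin \<gamma> = 0" "(proj 1 *v ket \<beta>) /\<^sub>R norm (proj 1 *v ket \<beta>) = ket \<gamma>"
proof
  show "sin (if cos \<beta> > 0 then 0 else pi) = 0" by simp
  show "(proj 1 *v ket \<beta>) /\<^sub>R norm (proj 1 *v ket \<beta>) = ket (if cos \<beta> > 0 then 0 else pi)"
    using assms unfolding norm_proj_ket
    by (auto simp: vec_eq_iff forall_2 ket_def proj_def matrix_vector_mult_def sum_2
        scaleR_conv_of_real[where 'a = complex] simp flip: of_real_mult)
qed

section \<open>Lower bound for the sine away from the multiples of \<open>pi\<close>\<close>

text \<open>Jordan's inequality: a concave function lies above its chord, here the one from 0 to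
  \<open>pi / 2\<close>.\<close>

lemma sin_ge_linear:
  assumes "0 \<le> x" "x \<le> pi / 2"
  shows "2 * x / pi \<le> sin x"
proof -
  have "concave_on {0..pi} (sin :: real \<Rightarrow> real)"
    by (rule f''_le0_imp_concave[where f' = cos and f'' = "\<lambda>x. - sin x"])
       (auto intro!: derivative_eq_intros simp: sin_ge_zero)
  from concave_onD[OF this, of "2 * x / pi" 0 "pi / 2"] show ?thesis
    using assms by (simp add: field_simps)
qed

text \<open>Modulo \<open>pi\<close> the angle keeps distance at least \<open>pi / p\<close> from
  both 0 and \<open>pi\<close>, so the linear bound even gives a sine of at least
  \<open>2 / p\<close>; the reflection \<open>pi - x\<close> handles the right half.\<close>

lemma sin_squared_pi_quotient_ge:
  fixes n p :: nat
  assumes "p > 0" "\<not> p dvd n"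
  shows "1 / real p ^ 2 \<le> (sin (real n * (pi / real p)))\<^sup>2"
proof -
  define m where "m = n mod p"
  have m: "0 < m" "m < p"
    using assms by (auto simp: m_def mod_greater_zero_iff_not_dvd)
  define x where "x = real m * pi / real p"
  have "real n = real (n div p) * real p + real m"
    unfolding m_def by (metis div_mult_mod_eq of_nat_add of_nat_mult)
  then have eq: "real n * (pi / real p) = x + real (n div p) * pi"
    using assms(1) by (simp add: x_def field_simps)
  \<comment> \<open>Shifting by a multiple of \<open>pi\<close> changes at most the sign, which
    squaring removes.\<close>
  have sq: "(sin (real n * (pi / real p)))\<^sup>2 = (sin x)\<^sup>2"
    unfolding eq by (simp add: sin_add power_mult_distrib flip: power_mult)
  have "1 / real p \<le> sin x"
  proof (cases "x \<le> pi / 2")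
    case True
    have "1 / real p \<le> 2 * x / pi"
      using m by (simp add: x_def field_simps)
    also have "\<dots> \<le> sin x"
      using True by (intro sin_ge_linear) (simp_all add: x_def)
    finally show ?thesis .
  next
    case False
    have "1 / real p \<le> 2 * (real p - real m) / real p"
      using m by (intro divide_right_mono) auto
    also have "\<dots> = 2 * (pi - x) / pi"
      using m by (simp add: x_def field_simps)
    also have "\<dots> \<le> sin (pi - x)"
      using False m by (intro sin_ge_linear) (simp_all add: x_def field_simps)
    finally show ?thesis by simp
  qed
  then have "(1 / real p)\<^sup>2 \<le> (sin x)\<^sup>2"
    by (intro power_mono) simp_all
  then show ?thesis by (simp only: sq power_divide power_one)
qed

section \<open>Series that repeat in geometrically decaying blocks\<close>

text \<open>Every series in \<open>ennreal\<close> is summable, so grouping its terms keeps the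
  sum.\<close>

lemma suminf_ennreal_blocks:
  fixes f :: "nat \<Rightarrow> ennreal"
  assumes "T > 0"
  shows "(\<Sum>t. f t) = (\<Sum>k. \<Sum>j<T. f (k * T + j))"
proof -
  have "(\<lambda>k. sum f {k * T..<k * T + T}) sums suminf f"
    using assms by (intro sums_group) auto
  moreover have "sum f {k * T..<k * T + T} = (\<Sum>j<T. f (k * T + j))" for k
    by (simp add: sum.atLeastLessThan_shift_0[of f] lessThan_atLeast0 o_def)
  ultimately show ?thesis by (simp add: sums_iff)
qed

text \<open>A block will be one round of the automaton: \<open>T\<close> is its length,
  \<open>b\<close> gives the probabilities of halting at its steps, and \<open>q\<close> is the
  probability of starting another round.\<close>

context
  fixes f b :: "nat \<Rightarrow> real" and T :: nat and q :: real
  assumes blocks: "\<And>k j. j < T \<Longrightarrow> f (k * T + j) = q ^ k * b j"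
    and b_nonneg: "\<And>j. 0 \<le> b j" and q: "0 \<le> q" "q < 1" and T: "T > 0"
begin

lemma suminf_geometric_blocks: "(\<Sum>t. ennreal (f t)) = ennreal ((\<Sum>j<T. b j) / (1 - q))"
proof -
  have "(\<Sum>j<T. ennreal (f (k * T + j))) = ennreal (q ^ k * (\<Sum>j<T. b j))" for k
    using b_nonneg q by (simp add: blocks sum_distrib_left)
  moreover have "(\<lambda>k. q ^ k * (\<Sum>j<T. b j)) sums (1 / (1 - q) * (\<Sum>j<T. b j))"
    using q by (intro sums_mult2 geometric_sums) simp
  ultimately show ?thesis
    using b_nonneg q
    by (subst suminf_ennreal_blocks[OF T]) (simp add: sum_nonneg suminf_ennreal_eq sums_unique[symmetric])
qed

text \<open>Each index in block \<open>k\<close> is at most \<open>(k + 1) * T\<close>, and the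
  series of \<open>(k + 1) * q ^ k\<close> is the derivative of the geometric series, with sum
  \<open>1 / (1 - q) ^ 2\<close>.\<close>

lemma suminf_times_geometric_blocks_le:
  "(\<Sum>t. of_nat t * ennreal (f t)) \<le> ennreal (T * (\<Sum>j<T. b j) / (1 - q)\<^sup>2)"
proof -
  define B where "B = (\<Sum>j<T. b j)"
  have B: "0 \<le> B" by (simp add: B_def sum_nonneg b_nonneg)
  have "(\<Sum>j<T. of_nat (k * T + j) * ennreal (f (k * T + j)))
      \<le> ennreal (real (Suc k) * q ^ k * (T * B))" (is "?l \<le> ?r") for k
  proof -
    have mult: "of_nat t * ennreal x = ennreal (real t * x)" if "0 \<le> x" for t x
      using that by (simp add: ennreal_of_nat_eq_real_of_nat ennreal_mult)
    have "?l = (\<Sum>j<T. ennreal (real (k * T + j) * (q ^ k * b j)))"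
      using b_nonneg q by (intro sum.cong refl) (simp only: blocks lessThan_iff, rule mult, simp)
    also have "\<dots> = ennreal (\<Sum>j<T. real (k * T + j) * (q ^ k * b j))"
      using b_nonneg q by (intro sum_ennreal) simp
    also have "\<dots> \<le> ennreal (\<Sum>j<T. (real (Suc k) * T) * (q ^ k * b j))"
    proof (intro ennreal_leI sum_mono mult_right_mono)
      fix j assume "j \<in> {..<T}"
      then have "k * T + j \<le> Suc k * T" by simp
      then show "real (k * T + j) \<le> real (Suc k) * real T"
        unfolding of_nat_mult[symmetric] of_nat_le_iff .
    qed (use b_nonneg q in simp)
    also have "\<dots> = ?r"
      by (simp only: B_def sum_distrib_left mult_ac)
    finally show ?thesis .
  qed
  then have "(\<Sum>t. of_nat t * ennreal (f t)) \<le> (\<Sum>k. ennreal (real (Suc k) * q ^ k * (T * B)))"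
    by (subst suminf_ennreal_blocks[OF T]) (intro suminf_le, auto)
  also have "\<dots> = ennreal (1 / (1 - q)\<^sup>2 * (T * B))"
    using q B geometric_deriv_sums[of q]
    by (intro suminf_ennreal_eq sums_mult2) auto
  finally show ?thesis by (simp add: B_def)
qed

end

section \<open>The automaton\<close>

text \<open>
  State 0 returns to the left end; states 1 and 2 rotate by \<open>\<alpha>\<close> on the first and the later
  letters (state 1 exists to reject the empty word), state 2 measuring at the right end; states 3
  and 4 toss a coin of bias \<open>sin\<^sup>2 \<theta>\<close> by a rotation and a measurement; 5 accepts and 6 rejects.
\<close>

definition rot_qcfa :: "'a \<Rightarrow> real \<Rightarrow> real \<Rightarrow> (2, nat, 'a) qcfa" where
  "rot_qcfa a \<alpha> \<theta> = \<lparr>states = {..<7}, alphabet = {a},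
     Theta = (\<lambda>s \<sigma>. if s = 2 \<and> \<sigma> = Right_End \<or> s = 4 then Measurement [proj 1, proj 2]
       else Unitary (rot (if s = 1 \<or> s = 2 then \<alpha> else if s = 3 then \<theta> else 0))),
     delta = (\<lambda>s \<sigma> i.
       if s = 0 then if \<sigma> = Left_End then (1, 1) else (0, -1)
       else if s = 1 then if \<sigma> = Right_End then (6, 0) else (2, 1)
       else if s = 2 then if \<sigma> = Right_End then (if i = 0 then 3 else 6, 0) else (2, 1)
       else if s = 3 then (4, 0)
       else if i = 0 then (0, if \<sigma> = Left_End then 0 else -1) else (5, 0)),
     init_quantum = 1, init_state = 0, acc_states = {5}, rej_states = {6}\<rparr>"

lemma Theta_rot_qcfa:
  "Theta (rot_qcfa a \<alpha> \<theta>) s \<sigma> =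
     (if s = 2 \<and> \<sigma> = Right_End \<or> s = 4 then Measurement [proj 1, proj 2]
      else Unitary (rot (if s = 1 \<or> s = 2 then \<alpha> else if s = 3 then \<theta> else 0)))"
  by (simp add: rot_qcfa_def)

lemma delta_rot_qcfa:
  "delta (rot_qcfa a \<alpha> \<theta>) s \<sigma> i =
     (if s = 0 then if \<sigma> = Left_End then (1, 1) else (0, -1)
      else if s = 1 then if \<sigma> = Right_End then (6, 0) else (2, 1)
      else if s = 2 then if \<sigma> = Right_End then (if i = 0 then 3 else 6, 0) else (2, 1)
      else if s = 3 then (4, 0)
      else if i = 0 then (0, if \<sigma> = Left_End then 0 else -1) else (5, 0))"
  by (simp add: rot_qcfa_def)

lemma rot_qcfa_simps [simp]:
  "states (rot_qcfa a \<alpha> \<theta>) = {..<7}"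
  "init_state (rot_qcfa a \<alpha> \<theta>) = 0"
  "alphabet (rot_qcfa a \<alpha> \<theta>) = {a}"
  "acc_states (rot_qcfa a \<alpha> \<theta>) = {5}"
  "rej_states (rot_qcfa a \<alpha> \<theta>) = {6}"
  "halting_states (rot_qcfa a \<alpha> \<theta>) = {5, 6}"
  "initial_config (rot_qcfa a \<alpha> \<theta>) = (0, 0, ket 0)"
  by (auto simp: rot_qcfa_def halting_states_def initial_config_def axis_1_eq_ket)

lemma num_classical_states_rot_qcfa: "num_classical_states (rot_qcfa a \<alpha> \<theta>) = 7"
  by (simp add: num_classical_states_def)

lemma is_qcfa_rot_qcfa: "is_qcfa (rot_qcfa a \<alpha> \<theta>)"
proof -
  \<comment> \<open>Moves must be legal for every state and symbol, reachable or not, which is why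
    state 4 stays put on \<open>Left_End\<close>.\<close>
  have valid: "valid_move (rot_qcfa a \<alpha> \<theta>) \<sigma> (delta (rot_qcfa a \<alpha> \<theta>) s \<sigma> i)" for s \<sigma> i
    by (simp add: valid_move_def delta_rot_qcfa)
  show ?thesis
    by (simp add: is_qcfa_def Theta_rot_qcfa is_unitary_rot is_projective_measurement_proj valid)
qed

section \<open>Halting-time distributions of the phases of a round\<close>

text \<open>The halting-time distribution \<open>f\<close> preceded by \<open>k\<close> steps.
  Stating the recursion as equations between functions of time lets phases be chained by adding
  delays.\<close>

definition delay :: "nat \<Rightarrow> (nat \<Rightarrow> real) \<Rightarrow> nat \<Rightarrow> real" where
  "delay k f t = (if t < k then 0 else f (t - k))"

lemma delay_0 [simp]: "delay 0 f = f"
  by (simp add: delay_def fun_eq_iff)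

lemma delay_delay [simp]: "delay k (delay l f) = delay (k + l) f"
  by (auto simp: delay_def fun_eq_iff)

context
  fixes a :: 'a and \<alpha> \<theta> :: real and n :: nat and X :: "nat set"
begin

abbreviation (input) H :: "nat \<Rightarrow> int \<Rightarrow> complex ^ 2 \<Rightarrow> nat \<Rightarrow> real" where
  "H s h \<psi> t \<equiv> halt_prob (rot_qcfa a \<alpha> \<theta>) (replicate n a) X t (s, h, \<psi>)"

lemma halt_prob_halting:
  "s \<in> {5, 6} \<Longrightarrow> H s h \<psi> = (\<lambda>t. if t = 0 \<and> s \<in> X then 1 else 0)"
  by (rule ext, rename_tac t, case_tac t) auto

lemma halt_prob_Suc:
  "s \<notin> {5, 6} \<Longrightarrow> H s h \<psi> =
     delay 1 (\<lambda>t. \<Sum>(p, c') \<leftarrow> successors (rot_qcfa a \<alpha> \<theta>) (replicate n a) (s, h, \<psi>).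
       p * halt_prob (rot_qcfa a \<alpha> \<theta>) (replicate n a) X t c')"
  by (rule ext, rename_tac t, case_tac t) (auto simp: delay_def)

lemma scanned_replicate:
  "scanned (replicate n a) h =
     (if h \<le> 0 then Left_End else if h \<le> int n then Letter a else Right_End)"
  by (simp add: scanned_def)

text \<open>The assumptions exclude exactly the measuring situations among non-halting states: state
  4 anywhere and state 2 at the right end.\<close>

lemma halt_prob_unitary:
  assumes "s \<notin> {5, 6}" "s \<noteq> 4" "s = 2 \<Longrightarrow> h \<le> int n"
    and "delta (rot_qcfa a \<alpha> \<theta>) s (scanned (replicate n a) h) 0 = (s', d)"
  shows "H s h (ket \<beta>) =
    delay 1 (H s' (h + d) (ket (\<beta> + (if s = 1 \<or> s = 2 then \<alpha> else if s = 3 then \<theta> else 0))))"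
  using assms
  by (subst halt_prob_Suc) (auto simp: Theta_rot_qcfa Let_def rot_mult_ket scanned_replicate)

lemma halt_prob_return: "k \<le> n \<Longrightarrow> H 0 (int k) (ket \<beta>) = delay k (H 0 0 (ket \<beta>))"
proof (induction k)
  case (Suc k)
  have "H 0 (int (Suc k)) (ket \<beta>) = delay 1 (H 0 (int k) (ket \<beta>))"
    by (subst halt_prob_unitary) (use Suc.prems in \<open>auto simp: scanned_replicate delta_rot_qcfa\<close>)
  then show ?case using Suc by simp
qed simp

text \<open>Here \<open>k\<close> counts the letters still to be read, including the scanned one;
  each costs one step and adds \<open>\<alpha>\<close> to the angle.\<close>

lemma halt_prob_rotate:
  "k \<le> n \<Longrightarrow> h = int (n + 1 - k) \<Longrightarrow>
   H 2 h (ket \<beta>) = delay k (H 2 (int n + 1) (ket (\<beta> + k * \<alpha>)))"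
proof (induction k arbitrary: h \<beta>)
  case 0
  then have "h = int n + 1" by simp
  then show ?case by simp
next
  case (Suc k)
  have "H 2 h (ket \<beta>) = delay 1 (H 2 (h + 1) (ket (\<beta> + \<alpha>)))"
    by (subst halt_prob_unitary) (use Suc.prems in \<open>auto simp: scanned_replicate delta_rot_qcfa\<close>)
  also have "H 2 (h + 1) (ket (\<beta> + \<alpha>))
      = delay k (H 2 (int n + 1) (ket (\<beta> + \<alpha> + k * \<alpha>)))"
    using Suc.prems by (intro Suc.IH) auto
  finally show ?case by (simp add: algebra_simps)
qed

text \<open>
  The residual state for outcome 0 is \<open>ket \<gamma>\<close> with \<open>sin \<gamma> = 0\<close>, i.e. the first basis state up to
  sign; when \<open>cos \<beta> = 0\<close> the angle \<open>\<gamma>\<close> is arbitrary, since its weight vanishes.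
\<close>

lemma halt_prob_measure:
  assumes "s = 2 \<or> s = 4" "s'' \<in> {5, 6}"
    and "delta (rot_qcfa a \<alpha> \<theta>) s Right_End 0 = (s', d)"
    and "delta (rot_qcfa a \<alpha> \<theta>) s Right_End 1 = (s'', 0)"
  obtains \<gamma> where "sin \<gamma> = 0"
    "H s (int n + 1) (ket \<beta>) =
       delay 1 (\<lambda>t. (cos \<beta>)\<^sup>2 * H s' (int n + 1 + d) (ket \<gamma>) t
         + (sin \<beta>)\<^sup>2 * (if t = 0 \<and> s'' \<in> X then 1 else 0))"
proof -
  obtain \<gamma> where \<gamma>: "sin \<gamma> = 0" and
    ket: "cos \<beta> \<noteq> 0 \<Longrightarrow> (proj 1 *v ket \<beta>) /\<^sub>R norm (proj 1 *v ket \<beta>) = ket \<gamma>"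
  proof (cases "cos \<beta> = 0")
    case True
    then show ?thesis using that[of 0] by simp
  next
    case False
    then show ?thesis using that normalized_proj_1_ket by blast
  qed
  define \<phi> where "\<phi> k = (proj k *v ket \<beta>) /\<^sub>R norm (proj k *v ket \<beta>)" for k
  have scan: "scanned (replicate n a) (int n + 1) = Right_End"
    by (simp add: scanned_replicate)
  have succ: "successors (rot_qcfa a \<alpha> \<theta>) (replicate n a) (s, int n + 1, ket \<beta>) =
      [((cos \<beta>)\<^sup>2, (s', int n + 1 + d, \<phi> 1)), ((sin \<beta>)\<^sup>2, (s'', int n + 1, \<phi> 2))]"
    using assms(1,3,4)
    by (auto simp: scan Theta_rot_qcfa Let_def norm_proj_ket \<phi>_def)
  have cong: "(cos \<beta>)\<^sup>2 * H s' (int n + 1 + d) (\<phi> 1) t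
      = (cos \<beta>)\<^sup>2 * H s' (int n + 1 + d) (ket \<gamma>) t" for t
    using ket by (cases "cos \<beta> = 0") (auto simp: \<phi>_def)
  have "H s (int n + 1) (ket \<beta>) =
      delay 1 (\<lambda>t. (cos \<beta>)\<^sup>2 * H s' (int n + 1 + d) (\<phi> 1) t + (sin \<beta>)\<^sup>2 * H s'' (int n + 1) (\<phi> 2) t)"
    using assms(1) by (subst halt_prob_Suc) (auto simp: succ simp del: successors.simps)
  also have "\<dots> = delay 1 (\<lambda>t. (cos \<beta>)\<^sup>2 * H s' (int n + 1 + d) (ket \<gamma>) t
         + (sin \<beta>)\<^sup>2 * (if t = 0 \<and> s'' \<in> X then 1 else 0))"
    by (simp only: cong fun_cong[OF halt_prob_halting[OF assms(2)]])
  finally show ?thesis using that \<gamma> by blast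
qed

section \<open>One round and its repetition\<close>

context
  fixes r d q :: real
  assumes n: "n > 0"
    and r_def: "r = (sin (n * \<alpha>))\<^sup>2" and d_def: "d = (sin \<theta>)\<^sup>2" and q_def: "q = (1 - r) * (1 - d)"
begin

text \<open>Leaving the left end, \<open>n\<close> letters and the measurement take
  \<open>n + 2\<close> steps; the coin takes 2 more. The coin measurement already moves left to cell
  \<open>n\<close>, so returning takes \<open>n\<close> further steps, \<open>2 * n + 4\<close> in
  all. The new angle again has sine 0, so the description can be iterated.\<close>

lemma halt_prob_round:
  assumes "sin \<beta> = 0"
  obtains \<gamma> where "sin \<gamma> = 0"
    "\<And>t. H 0 0 (ket \<beta>) t =
       (if t = n + 2 \<and> 6 \<in> X then r else 0) + (if t = n + 4 \<and> 5 \<in> X then (1 - r) * d else 0) +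
       (if t \<ge> 2 * n + 4 then q * H 0 0 (ket \<gamma>) (t - (2 * n + 4)) else 0)"
proof -
  \<comment> \<open>The sign of the starting state does not affect the outcome
    probabilities.\<close>
  have sin: "(sin (\<beta>' + x))\<^sup>2 = (sin x)\<^sup>2" and cos: "(cos (\<beta>' + x))\<^sup>2 = 1 - (sin x)\<^sup>2"
    if "sin \<beta>' = 0" for \<beta>' x :: real
    using that sin_cos_squared_add[of \<beta>']
    by (simp_all add: sin_add cos_add power_mult_distrib cos_squared_eq)
  have "H 0 0 (ket \<beta>) = delay 1 (H 1 1 (ket \<beta>))"
    by (subst halt_prob_unitary) (auto simp: scanned_replicate delta_rot_qcfa)
  also have "H 1 1 (ket \<beta>) = delay 1 (H 2 2 (ket (\<beta> + \<alpha>)))"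
    by (subst halt_prob_unitary) (use n in \<open>auto simp: scanned_replicate delta_rot_qcfa\<close>)
  also have "H 2 2 (ket (\<beta> + \<alpha>)) = delay (n - 1) (H 2 (int n + 1) (ket (\<beta> + \<alpha> + (n - 1) * \<alpha>)))"
    using n by (intro halt_prob_rotate) auto
  also have "\<beta> + \<alpha> + (n - 1) * \<alpha> = \<beta> + n * \<alpha>"
    using n by (simp add: algebra_simps)
  finally have 1: "H 0 0 (ket \<beta>) = delay (n + 1) (H 2 (int n + 1) (ket (\<beta> + n * \<alpha>)))"
    using n by simp
  obtain \<gamma>1 where \<gamma>1: "sin \<gamma>1 = 0" and 2: "H 2 (int n + 1) (ket (\<beta> + n * \<alpha>)) =
      delay 1 (\<lambda>t. (1 - r) * H 3 (int n + 1) (ket \<gamma>1) t + r * (if t = 0 \<and> 6 \<in> X then 1 else 0))"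
    by (rule halt_prob_measure[where s = 2 and s'' = 6 and s' = 3 and d = 0 and \<beta> = "\<beta> + n * \<alpha>"])
       (auto simp: delta_rot_qcfa r_def sin[OF assms] cos[OF assms])
  have 3: "H 3 (int n + 1) (ket \<gamma>1) = delay 1 (H 4 (int n + 1) (ket (\<gamma>1 + \<theta>)))"
    by (subst halt_prob_unitary) (auto simp: scanned_replicate delta_rot_qcfa)
  obtain \<gamma>2 where \<gamma>2: "sin \<gamma>2 = 0" and 4: "H 4 (int n + 1) (ket (\<gamma>1 + \<theta>)) =
      delay 1 (\<lambda>t. (1 - d) * H 0 (int n) (ket \<gamma>2) t + d * (if t = 0 \<and> 5 \<in> X then 1 else 0))"
    by (rule halt_prob_measure[where s = 4 and s'' = 5 and s' = 0 and d = "-1" and \<beta> = "\<gamma>1 + \<theta>"])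
       (auto simp: delta_rot_qcfa d_def sin[OF \<gamma>1] cos[OF \<gamma>1])
  have 5: "H 0 (int n) (ket \<gamma>2) = delay n (H 0 0 (ket \<gamma>2))"
    by (rule halt_prob_return) simp
  show ?thesis
  proof (rule that[OF \<gamma>2])
    fix t
    have T: "2 * n + 4 = Suc (Suc (Suc (Suc (n + n))))" by simp
    show "H 0 0 (ket \<beta>) t =
       (if t = n + 2 \<and> 6 \<in> X then r else 0) + (if t = n + 4 \<and> 5 \<in> X then (1 - r) * d else 0) +
       (if t \<ge> 2 * n + 4 then q * H 0 0 (ket \<gamma>2) (t - (2 * n + 4)) else 0)"
      unfolding fun_cong[OF 1] 2 fun_cong[OF 3] 4 fun_cong[OF 5] q_def T using n
      by (auto simp: delay_def)
  qed
qed

text \<open>Induction on the completed rounds, with the angle generalised because each round may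
  flip the sign of the state.\<close>

lemma halt_prob_rounds:
  assumes "j < 2 * n + 4"
  shows "sin \<beta> = 0 \<Longrightarrow> H 0 0 (ket \<beta>) (k * (2 * n + 4) + j) =
    q ^ k * ((if j = n + 2 \<and> 6 \<in> X then r else 0) + (if j = n + 4 \<and> 5 \<in> X then (1 - r) * d else 0))"
proof (induction k arbitrary: \<beta>)
  case 0
  obtain \<gamma> where "sin \<gamma> = 0"
    "\<And>t. H 0 0 (ket \<beta>) t =
       (if t = n + 2 \<and> 6 \<in> X then r else 0) + (if t = n + 4 \<and> 5 \<in> X then (1 - r) * d else 0) +
       (if t \<ge> 2 * n + 4 then q * H 0 0 (ket \<gamma>) (t - (2 * n + 4)) else 0)"
    using halt_prob_round[OF 0] by blast
  then show ?case using assms by simp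
next
  case (Suc k)
  obtain \<gamma> where "sin \<gamma> = 0" and \<gamma>:
    "\<And>t. H 0 0 (ket \<beta>) t =
       (if t = n + 2 \<and> 6 \<in> X then r else 0) + (if t = n + 4 \<and> 5 \<in> X then (1 - r) * d else 0) +
       (if t \<ge> 2 * n + 4 then q * H 0 0 (ket \<gamma>) (t - (2 * n + 4)) else 0)"
    using halt_prob_round[OF Suc.prems] by blast
  define t where "t = k * (2 * n + 4) + j"
  have "Suc k * (2 * n + 4) + j = (2 * n + 4) + t" by (simp add: t_def)
  \<comment> \<open>The halting times \<open>n + 2\<close> and \<open>n + 4\<close> of the first
    round both lie below \<open>2 * n + 4\<close> because \<open>n > 0\<close>, so only the
    continuation contributes.\<close>
  moreover have "H 0 0 (ket \<beta>) ((2 * n + 4) + t) = q * H 0 0 (ket \<gamma>) t"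
    unfolding \<gamma> using n by simp
  ultimately show ?case
    using Suc.IH[OF \<open>sin \<gamma> = 0\<close>] by (simp only: t_def power_Suc mult.assoc)
qed

text \<open>\<open>B\<close> is the probability that a single round halts in \<open>X\<close>.
  Keeping \<open>X\<close> arbitrary serves acceptance, rejection and running time at once.\<close>

lemma halt_prob_sums:
  assumes "d > 0"
  defines "B \<equiv> (if 6 \<in> X then r else 0) + (if 5 \<in> X then (1 - r) * d else 0)"
  shows "(\<Sum>t. ennreal (H 0 0 (ket 0) t)) = ennreal (B / (1 - q))"
    and "(\<Sum>t. of_nat t * ennreal (H 0 0 (ket 0) t)) \<le> ennreal (real (2 * n + 4) * B / (1 - q)\<^sup>2)"
proof -
  define b where "b j = (if j = n + 2 \<and> 6 \<in> X then r else 0)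
    + (if j = n + 4 \<and> 5 \<in> X then (1 - r) * d else 0)" for j
  have r: "0 \<le> r" "r \<le> 1" and d: "d \<le> 1"
    by (simp_all add: r_def d_def abs_square_le_1)
  \<comment> \<open>The coin alone bounds \<open>q\<close> away from 1, whatever \<open>r\<close>
    is.\<close>
  have "q \<le> 1 * (1 - d)"
    unfolding q_def using r d by (intro mult_right_mono) auto
  then have q: "0 \<le> q" "q < 1"
    using r d assms(1) by (simp_all add: q_def)
  have B: "(\<Sum>j<2 * n + 4. b j) = B"
    unfolding b_def B_def using n by (cases "6 \<in> X"; cases "5 \<in> X") (simp_all add: sum.distrib)
  have rounds: "H 0 0 (ket 0) (k * (2 * n + 4) + j) = q ^ k * b j" if "j < 2 * n + 4" for k j
    unfolding b_def by (rule halt_prob_rounds[OF that]) simp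
  have b: "0 \<le> b j" for j
    using r assms(1) by (simp add: b_def)
  show "(\<Sum>t. ennreal (H 0 0 (ket 0) t)) = ennreal (B / (1 - q))"
    unfolding B[symmetric] by (rule suminf_geometric_blocks[OF rounds b q]) auto
  show "(\<Sum>t. of_nat t * ennreal (H 0 0 (ket 0) t)) \<le> ennreal (real (2 * n + 4) * B / (1 - q)\<^sup>2)"
    unfolding B[symmetric] by (rule suminf_times_geometric_blocks_le[OF rounds b q]) auto
qed

end

end

section \<open>Total probabilities and expected running time on nonempty words\<close>

lemma rot_qcfa_probabilities:
  fixes n :: nat and \<alpha> \<theta> :: real and a :: 'a
  assumes "n > 0" "sin \<theta> \<noteq> 0"
  defines "A \<equiv> rot_qcfa a \<alpha> \<theta>" and "w \<equiv> replicate n a"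
    and "r \<equiv> (sin (n * \<alpha>))\<^sup>2" and "d \<equiv> (sin \<theta>)\<^sup>2"
  shows "accept_prob A w = ennreal ((1 - r) * d / (r + (1 - r) * d))"
    and "reject_prob A w = ennreal (r / (r + (1 - r) * d))"
    and "expected_running_time A w \<le> ennreal (real (2 * n + 4) / d)"
proof -
  define q where "q = (1 - r) * (1 - d)"
  \<comment> \<open>The probability that a round halts: by rejection, or by passing the measurement
    and then accepting.\<close>
  define e where "e = r + (1 - r) * d"
  have e: "1 - q = e" by (simp add: q_def e_def algebra_simps)
  have d: "0 < d" "d \<le> 1" using assms(2) by (simp_all add: d_def abs_square_le_1)
  have "d \<le> e"
    using mult_right_mono[of d 1 r] d by (simp add: e_def algebra_simps r_def)
  then have "e > 0" using d by simp
  note sums = halt_prob_sums[where a = a and \<alpha> = \<alpha> and \<theta> = \<theta> and n = n and r = r and d = d and q = q,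
      OF assms(1) meta_eq_to_obj_eq[OF r_def] meta_eq_to_obj_eq[OF d_def] q_def d(1), unfolded e]
  show "accept_prob A w = ennreal ((1 - r) * d / (r + (1 - r) * d))"
    by (simp add: accept_prob_def A_def w_def sums(1) e_def)
  show "reject_prob A w = ennreal (r / (r + (1 - r) * d))"
    by (simp add: reject_prob_def A_def w_def sums(1) e_def)
  \<comment> \<open>The sum is 1, so the automaton halts almost surely and the infinite term of the
    expected running time vanishes.\<close>
  have "(\<Sum>t. running_time_prob A w t) = ennreal (e / e)"
    by (simp add: running_time_prob_def A_def w_def sums(1)) (simp add: e_def)
  then have "expected_running_time A w = (\<Sum>t. of_nat t * running_time_prob A w t)"
    using \<open>e > 0\<close> by (simp add: expected_running_time_def)
  also have "\<dots> \<le> ennreal (real (2 * n + 4) * e / e\<^sup>2)"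
    unfolding running_time_prob_def A_def w_def using sums(2)[of "{5, 6}"] by (simp add: e_def)
  also have "real (2 * n + 4) * e / e\<^sup>2 = real (2 * n + 4) / e"
    using \<open>e > 0\<close> by (simp add: power2_eq_square)
  also have "\<dots> \<le> real (2 * n + 4) / d"
    using \<open>d \<le> e\<close> d by (intro divide_left_mono) auto
  finally show "expected_running_time A w \<le> ennreal (real (2 * n + 4) / d)"
    by (simp add: ennreal_leI)
qed

text \<open>The analysis by rounds assumes \<open>n > 0\<close>. On the empty word, state 1 meets
  the right end at once and rejects at time 2; this one term of the series suffices.\<close>

lemma reject_prob_rot_qcfa_Nil: "reject_prob (rot_qcfa a \<alpha> \<theta>) [] \<ge> 1"
proof -
  have "halt_prob (rot_qcfa a \<alpha> \<theta>) [] {6} 2 (0, 0, ket 0) = 1"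
    by (simp add: numeral_2_eq_2 scanned_def Theta_rot_qcfa delta_rot_qcfa)
  then have "1 = (\<Sum>t\<in>{2}. ennreal (halt_prob (rot_qcfa a \<alpha> \<theta>) [] {6} t (0, 0, ket 0)))"
    by simp
  also have "\<dots> \<le> reject_prob (rot_qcfa a \<alpha> \<theta>) []"
    unfolding reject_prob_def rot_qcfa_simps by (intro sum_le_suminf) auto
  finally show ?thesis .
qed

section \<open>Choice of the parameters and the error bound\<close>

theorem theorem2:
  fixes a :: 'a
  shows "\<exists>(N::nat) (C::real). C > 0 \<and>
    (\<forall>(p::nat) (\<epsilon>::real). p > 0 \<and> 0 < \<epsilon> \<and> \<epsilon> \<le> 1/2 \<longrightarrow>
      (\<exists>A :: (2, nat, 'a) qcfa.
         is_qcfa A \<and> alphabet A = {a} \<and>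
         num_quantum_states A = 2 \<and> num_classical_states A = N \<and>
         recognizes_one_sided A (multiples_language a p) \<epsilon> \<and>
         (\<forall>w \<in> lists {a}. length w \<ge> 1 \<longrightarrow>
            expected_running_time A w \<le>
              ennreal (C * ((1 / \<epsilon>) * real p ^ 2 * real (length w))))))"
proof (rule exI[of _ 7], rule exI[of _ 6], intro conjI allI impI)
  fix p :: nat and \<epsilon> :: real
  assume "p > 0 \<and> 0 < \<epsilon> \<and> \<epsilon> \<le> 1/2"
  then have p: "p > 0" and \<epsilon>: "0 < \<epsilon>" "\<epsilon> \<le> 1/2" by auto
  \<comment> \<open>A nonmember is rejected with probability at least \<open>1 / p ^ 2\<close> per
    round, so this bias makes accepting at most \<open>\<epsilon>\<close> times as likely as
    rejecting.\<close>
  define d where "d = \<epsilon> / real p ^ 2"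
  have "\<epsilon> \<le> real p ^ 2"
    using p \<epsilon> one_le_power[of "real p" 2] by linarith
  then have d: "0 < d" "d \<le> 1" using p \<epsilon> by (simp_all add: d_def)
  \<comment> \<open>This angle gives the coin exactly bias \<open>d\<close>; \<open>arcsin\<close>
    applies because \<open>sqrt d\<close> is in \<open>[0, 1]\<close>.\<close>
  define \<theta> where "\<theta> = arcsin (sqrt d)"
  have \<theta>: "sin \<theta> \<noteq> 0" "(sin \<theta>)\<^sup>2 = d"
    using d by (simp_all add: \<theta>_def order_trans[of "-1" 0])
  define A where "A = rot_qcfa a (pi / real p) \<theta>"
  define r where "r n = (sin (real n * (pi / real p)))\<^sup>2" for n :: nat
  have lists: "w = replicate (length w) a" if "w \<in> lists {a}" for w
    using that by (induction w) auto
  note probs = rot_qcfa_probabilities[OF _ \<theta>(1), of _ a "pi / real p",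
      folded A_def, unfolded \<theta>(2), folded r_def]
  have accept: "accept_prob A w = 1" if "w \<in> multiples_language a p" for w
  proof -
    obtain k where k: "k > 0" "w = replicate (k * p) a"
      using \<open>w \<in> multiples_language a p\<close> by (auto simp: multiples_language_def)
    \<comment> \<open>The total rotation is \<open>k * pi\<close>, so rejection is impossible and
      the acceptance probability is \<open>d / d\<close>.\<close>
    have "r (k * p) = 0" using p by (simp add: r_def)
    then show ?thesis using probs(1)[of "k * p"] p k d by simp
  qed
  have reject: "reject_prob A w \<ge> ennreal (1 - \<epsilon>)"
    if w: "w \<in> lists {a} - multiples_language a p" for w
  proof (cases "w = []")
    case True
    then show ?thesis
      using reject_prob_rot_qcfa_Nil[of a "pi / real p" \<theta>] \<epsilon>
      by (auto simp: A_def intro: order_trans[of _ "1 :: ennreal"])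
  next
    case False
    define n where "n = length w"
    have n: "n > 0" "w = replicate n a" using False lists w by (auto simp: n_def)
    have "\<not> p dvd n"
    proof
      assume "p dvd n"
      then obtain k where "n = k * p" by (metis dvdE mult.commute)
      then show False using w n by (auto simp: multiples_language_def)
    qed
    then have r: "1 / real p ^ 2 \<le> r n"
      unfolding r_def using p by (intro sin_squared_pi_quotient_ge)
    then have "d \<le> \<epsilon> * r n"
      using mult_left_mono[OF r, of \<epsilon>] \<epsilon> by (simp add: d_def)
    have "0 < 1 / real p ^ 2" using p by simp
    then have r01: "0 < r n" "r n \<le> 1"
      using r by (linarith, simp add: r_def abs_square_le_1)
    \<comment> \<open>The left side is at most \<open>d\<close>, hence at most
      \<open>\<epsilon> * r n\<close>; adding \<open>(1 - \<epsilon>) * r n\<close> yields the error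
      bound with denominators cleared.\<close>
    then have "(1 - \<epsilon>) * ((1 - r n) * d) \<le> 1 * (1 * d)"
      using \<epsilon> d by (intro mult_mono) auto
    then have "(1 - \<epsilon>) * (r n + (1 - r n) * d) \<le> r n"
      using \<open>d \<le> \<epsilon> * r n\<close> by (simp add: algebra_simps)
    moreover have "0 < r n + (1 - r n) * d"
      using r01 d by (intro add_pos_nonneg) auto
    ultimately have "1 - \<epsilon> \<le> r n / (r n + (1 - r n) * d)"
      by (simp add: pos_le_divide_eq)
    then show ?thesis using probs(2)[OF n(1)] n(2) by (simp add: ennreal_leI)
  qed
  have time: "expected_running_time A w \<le> ennreal (6 * ((1 / \<epsilon>) * real p ^ 2 * real (length w)))"
    if w: "w \<in> lists {a}" "length w \<ge> 1" for w
  proof -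
    \<comment> \<open>The source of the constant 6: the length of a round is linear in the input
      length once that is at least 1.\<close>
    have "real (2 * length w + 4) \<le> 6 * real (length w)" using w by simp
    then have "real (2 * length w + 4) / d \<le> 6 * real (length w) / d"
      using d by (intro divide_right_mono) auto
    also have "\<dots> = 6 * ((1 / \<epsilon>) * real p ^ 2 * real (length w))"
      by (simp add: d_def)
    finally have "ennreal (real (2 * length w + 4) / d)
        \<le> ennreal (6 * ((1 / \<epsilon>) * real p ^ 2 * real (length w)))"
      by (rule ennreal_leI)
    moreover have "expected_running_time A w \<le> ennreal (real (2 * length w + 4) / d)"
      using probs(3)[of "length w"] w(2) unfolding lists[OF w(1), symmetric] by linarith
    ultimately show ?thesis by (rule order_trans[rotated])
  qed
  have "multiples_language a p \<subseteq> lists {a}"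
    by (auto simp: multiples_language_def)
  then show "\<exists>A :: (2, nat, 'a) qcfa.
         is_qcfa A \<and> alphabet A = {a} \<and>
         num_quantum_states A = 2 \<and> num_classical_states A = 7 \<and>
         recognizes_one_sided A (multiples_language a p) \<epsilon> \<and>
         (\<forall>w \<in> lists {a}. length w \<ge> 1 \<longrightarrow>
            expected_running_time A w \<le>
              ennreal (6 * ((1 / \<epsilon>) * real p ^ 2 * real (length w))))"
    using accept reject time
    by (intro exI[of _ A])
       (simp add: recognizes_one_sided_def num_quantum_states_def A_def is_qcfa_rot_qcfa
          num_classical_states_rot_qcfa)
qed simp

end
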